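(* Let $p\ge1$, $b\in\mathbb C$, $\boldsymbol\kappa\in\mathbb C^p$ with $\kappa_i-\kappa_h\notin\mathbb Z$ for $i\ne h$ and $c_i:=\kappa_i+b+1\notin\{0,-1,-2,\dots\}$ for all $i$; put $\boldsymbol c=(c_1,\dots,c_p)$. Let $\boldsymbol n\in\mathbb N_0^p$, $P(t)=\prod_{i=1}^p(c_i+t)_{n_i}$, and let $B_{\boldsymbol n}$ be the monic scalar $B$-polynomial of the one-row case and $\mathcal K_{\boldsymbol n}$ the Kampé de Fériet polynomial defined in the context. Then $$B_{\boldsymbol n}(z)=\frac{P(0)}{|\boldsymbol n|!\,P(|\boldsymbol n|)}\,\mathcal K_{\boldsymbol n}(z).$$ Choose $i_*$ with $n_*:=n_{i_*}=\max_in_i$, set $c_*=c_{i_*}$, $S_*(t)=\prod_{i\ne i_*}(c_i+t)_{n_i}$, and define $$\mathcal Q_{\boldsymbol n}(x)=\sum_{j=0}^{|\boldsymbol n|-n_*}\frac{(-1)^j(-x)_j\,(n_*-x+j+1)_{|\boldsymbol n|-n_*-j}}{(c_*+n_* )_j\,(|\boldsymbol n|-n_*-j)!}\,\Delta^{|\boldsymbol n|-n_*-j}S_*(n_*+j).$$ Then $\mathcal Q_{\boldsymbol n}(0)=|\boldsymbol n|!/n_*!$, $\deg\mathcal Q_{\boldsymbol n}=|\boldsymbol n|-n_*$, and $$[x^{|\boldsymbol n|-n_*}]\mathcal Q_{\boldsymbol n}(x)=\frac{S_*(1-c_* )}{(c_*+n_* )_{|\boldsymbol n|-n_*}}=\frac{\prod_{i\ne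 i_*}(\kappa_i-\kappa_{i_*}+1)_{n_i}}{(\kappa_{i_*}+b+n_*+1)_{|\boldsymbol n|-n_*}} .$$ Let $\xi_1,\dots,\xi_{|\boldsymbol n|-n_*}$ be the zeros of $\mathcal Q_{\boldsymbol n}$ counted with multiplicity (none of them is $0$). Then $$\mathcal K_{\boldsymbol n}(z)=(-1)^{|\boldsymbol n|}\frac{|\boldsymbol n|!}{P(0)}\;{}_{|\boldsymbol n|-n_*+2}F_{|\boldsymbol n|-n_*}\!\left(\begin{matrix}-|\boldsymbol n|,\ c_*+n_*,\ 1-\xi_1,\dots,1-\xi_{|\boldsymbol n|-n_*}\\-\xi_1,\dots,-\xi_{|\boldsymbol n|-n_*}\end{matrix};z\right),$$ and consequently $$B_{\boldsymbol n}(z)=\frac{(-1)^{|\boldsymbol n|}}{P(|\boldsymbol n|)}\;{}_{|\boldsymbol n|-n_*+2}F_{|\boldsymbol n|-n_*}\!\left(\begin{matrix}-|\boldsymbol n|,\ c_*+n_*,\ 1-\xi_1,\dots,1-\xi_{|\boldsymbol n|-n_*}\\-\xi_1,\dots,-\xi_{|\boldsymbol n|-n_*}\end{matrix};z\right).$$ Here the strings involving $\xi_\ell$ are omitted when $|\boldsymbol n|=n_*$, and if some $\xi_\ell\in\{1,\dots,|\boldsymbol n|\}$ the hypergeometric expressions are understood coefficientwise, replacing $\frac{(1-\xi_\ell)_d}{(-\xi_\ell)_d}$ by $\frac{d-\xi_\ell}{-\xi_\ell}$ for $d\in\{0,\dots,|\boldsymbol n|\}$.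
   Context: $(x)_n=x(x+1)\cdots(x+n-1)$; for a vector, $(\boldsymbol c)_k=\prod_i(c_i)_k$; $|\boldsymbol n|=\sum n_i$; $\Delta F(t)=F(t+1)-F(t)$ and $\Delta^m$ is its $m$-fold iterate; $[x^k]F$ is the coefficient of $x^k$; ${}_sF_t(\boldsymbol\alpha;\boldsymbol\beta;z)=\sum_k\frac{(\boldsymbol\alpha)_k}{(\boldsymbol\beta)_k}\frac{z^k}{k!}$ (terminating here). One-row case ($q=1$, $r=0$, $b=b_1$, row index $|\boldsymbol n|+1$): $B_{\boldsymbol n}$ is $$B_{\boldsymbol n}(z)=\nu\sum_{K=0}^{|\boldsymbol n|}\pi_K\sum_{d=0}^{K}(-K)_d\,z^d,\qquad \pi_K=-\frac{P(K)}{(-1)^KK!\,(|\boldsymbol n|-K)!},\quad \nu=-\frac1{P(|\boldsymbol n|)},$$ which is the monic polynomial of degree $|\boldsymbol n|$ satisfying $\mathcal L_i[z^\ell B_{\boldsymbol n}]=0$ for $1\le i\le p$, $0\le\ell\le n_i-1$, where $\mathcal L_i[z^k]=1/\Gamma(k+\kappa_i+b+2)$. Kampé de Fériet polynomial: $$\mathcal K_{\boldsymbol n}(z)=F^{p+1:1;0}_{p:0;0}\left[\begin{matrix}-|\boldsymbol n|,\ \boldsymbol c+\boldsymbol n:1;\text{---}\\ \boldsymbol c:\text{---};\text{---}\end{matrix}\middle|-z,1\right]=\sum_{u,\lambda\ge0}\frac{(-|\boldsymbol n|)_{u+\lambda}\,(\boldsymbol c+\boldsymbol n)_{u+\lambda}\,(1)_u}{(\boldsymbol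 c)_{u+\lambda}}\frac{(-z)^u}{u!}\frac1{\lambda!}.$$ *)

theory Defs
  imports "HOL-Analysis.Analysis" "HOL-Computational_Algebra.Computational_Algebra"
begin

text \<open>
  Vectors of length \<open>p\<close> are functions on \<open>nat\<close> of which only the entries \<open>1, \<dots>, p\<close> are used.
\<close>

definition mi_size :: "nat \<Rightarrow> (nat \<Rightarrow> nat) \<Rightarrow> nat" where
  "mi_size p n = (\<Sum>i=1..p. n i)"

definition P_fun :: "nat \<Rightarrow> (nat \<Rightarrow> complex) \<Rightarrow> (nat \<Rightarrow> nat) \<Rightarrow> complex \<Rightarrow> complex" where
  "P_fun p c n t = (\<Prod>i=1..p. pochhammer (c i + t) (n i))"

definition S_fun ::
  "nat \<Rightarrow> (nat \<Rightarrow> complex) \<Rightarrow> (nat \<Rightarrow> nat) \<Rightarrow> nat \<Rightarrow> complex \<Rightarrow> complex" where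
  "S_fun p c n s t = (\<Prod>i\<in>{1..p} - {s}. pochhammer (c i + t) (n i))"

definition fwd_diff :: "(complex \<Rightarrow> complex) \<Rightarrow> complex \<Rightarrow> complex" where
  "fwd_diff F t = F (t + 1) - F t"

definition B_weight :: "nat \<Rightarrow> (nat \<Rightarrow> complex) \<Rightarrow> (nat \<Rightarrow> nat) \<Rightarrow> nat \<Rightarrow> complex" where
  "B_weight p c n K =
     - (P_fun p c n (of_nat K) / ((- 1) ^ K * fact K * fact (mi_size p n - K)))"

text \<open>
  The monic \<open>B\<close>-polynomial, given by its explicit formula; the data \<open>\<kappa>\<close>, \<open>b\<close> enter only through
  \<open>c\<^sub>i = \<kappa>\<^sub>i + b + 1\<close>. That it is monic of degree \<open>|n|\<close> and satisfies the orthogonality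
  relations is proved at the end of this theory.
\<close>

definition B_poly :: "nat \<Rightarrow> (nat \<Rightarrow> complex) \<Rightarrow> (nat \<Rightarrow> nat) \<Rightarrow> complex poly" where
  "B_poly p c n =
     smult (- (1 / P_fun p c n (of_nat (mi_size p n))))
       (\<Sum>K=0..mi_size p n. smult (B_weight p c n K)
          (\<Sum>d=0..K. monom (pochhammer (- of_nat K) d) d))"

definition poch_list :: "complex list \<Rightarrow> nat \<Rightarrow> complex" where
  "poch_list as k = (\<Prod>a\<leftarrow>as. pochhammer a k)"

text \<open>
  The general double series of Kampe de Feriet: \<open>as\<close>, \<open>bs\<close> are the upper and lower
  parameters coupled to \<open>u + l\<close>; \<open>as1\<close>, \<open>bs1\<close> those of \<open>u\<close>, and \<open>as2\<close>, \<open>bs2\<close> those of \<open>l\<close>.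
\<close>

definition kampe_de_feriet ::
  "complex list \<Rightarrow> complex list \<Rightarrow> complex list \<Rightarrow> complex list \<Rightarrow> complex list \<Rightarrow> complex list
     \<Rightarrow> complex \<Rightarrow> complex \<Rightarrow> complex" where
  "kampe_de_feriet as as1 as2 bs bs1 bs2 x y =
     (\<Sum>\<^sub>\<infinity>(u, l)\<in>UNIV.
        poch_list as (u + l) * poch_list as1 u * poch_list as2 l
        / (poch_list bs (u + l) * poch_list bs1 u * poch_list bs2 l)
        * (x ^ u / fact u) * (y ^ l / fact l))"

definition K_fun :: "nat \<Rightarrow> (nat \<Rightarrow> complex) \<Rightarrow> (nat \<Rightarrow> nat) \<Rightarrow> complex \<Rightarrow> complex" where
  "K_fun p c n z =
     kampe_de_feriet (- of_nat (mi_size p n) # map (\<lambda>i. c i + of_nat (n i)) [1..<Suc p]) [1] []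
       (map c [1..<Suc p]) [] [] (- z) 1"

text \<open>
  In the following, \<open>pochhammer [:0, - 1:] j\<close> is the polynomial \<open>(- x)\<^sub>j\<close> in \<open>x\<close>.
\<close>

definition Q_poly :: "nat \<Rightarrow> (nat \<Rightarrow> complex) \<Rightarrow> (nat \<Rightarrow> nat) \<Rightarrow> nat \<Rightarrow> complex poly" where
  "Q_poly p c n s =
     (let m = mi_size p n - n s in
      \<Sum>j=0..m.
        smult ((- 1) ^ j / (pochhammer (c s + of_nat (n s)) j * fact (m - j))
                 * (fwd_diff ^^ (m - j)) (S_fun p c n s) (of_nat (n s + j)))
          (pochhammer [:0, - 1:] j * pochhammer [:of_nat (n s + j + 1), - 1:] (m - j)))"

text \<open>
  The series with upper parameters \<open>- N\<close>, \<open>a\<close>, \<open>1 - \<xi>\<^sub>1\<close>, \<open>1 - \<xi>\<^sub>2\<close>, \<open>\<dots>\<close> and lower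
  parameters \<open>- \<xi>\<^sub>1\<close>, \<open>- \<xi>\<^sub>2\<close>, \<open>\<dots>\<close>. If some \<open>\<xi>\<^sub>l\<close> lies in \<open>{1, \<dots>, N}\<close>, then \<open>(- \<xi>\<^sub>l)\<^sub>d\<close> vanishes for
  some \<open>d \<le> N\<close>, and the coefficients are read with \<open>(1 - \<xi>\<^sub>l)\<^sub>d / (- \<xi>\<^sub>l)\<^sub>d\<close> replaced by
  \<open>(d - \<xi>\<^sub>l) / (- \<xi>\<^sub>l)\<close>. If \<open>\<xi>\<^sub>l\<close> is an integer greater than \<open>N\<close>, the vanishing denominators occur
  only at \<open>d > N\<close>, where \<open>(- N)\<^sub>d = 0\<close> and the term is \<open>0\<close>.
\<close>

definition hyp_xi :: "nat \<Rightarrow> complex \<Rightarrow> complex list \<Rightarrow> complex \<Rightarrow> complex" where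
  "hyp_xi N a xs z =
     (if set xs \<inter> of_nat ` {1..N} = {}
      then eval_fps (fps_hypergeo ([- of_nat N, a] @ map (\<lambda>x. 1 - x) xs) (map uminus xs) 1) z
      else (\<Sum>d=0..N. pochhammer (- of_nat N) d * pochhammer a d
              * (\<Prod>x\<leftarrow>xs. (of_nat d - x) / (- x)) * z ^ d / fact d))"

text \<open>The functionals \<open>L\<^sub>i\<close> on polynomials, with \<open>L\<^sub>i[z\<^sup>k] = 1 / \<Gamma>(k + \<kappa>\<^sub>i + b + 2)\<close>, \<open>a = c\<^sub>i\<close>.\<close>

definition L_fun :: "complex \<Rightarrow> complex poly \<Rightarrow> complex" where
  "L_fun a f = (\<Sum>k\<le>degree f. coeff f k / Gamma (of_nat k + a + 1))"

lemma L_fun_bound: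
  assumes "degree f \<le> M"
  shows "L_fun a f = (\<Sum>k\<le>M. coeff f k / Gamma (of_nat k + a + 1))"
  unfolding L_fun_def using assms
  by (intro sum.mono_neutral_left) (auto simp: coeff_eq_0)

lemma L_fun_add: "L_fun a (f + g) = L_fun a f + L_fun a g"
proof -
  define M where "M = max (degree f) (degree g)"
  have "degree f \<le> M" "degree g \<le> M" "degree (f + g) \<le> M"
    by (auto simp: M_def degree_add_le)
  then show ?thesis
    by (simp add: L_fun_bound[where M = M] sum.distrib add_divide_distrib)
qed

lemma L_fun_smult: "L_fun a (smult r f) = r * L_fun a f"
  by (simp add: L_fun_bound[where M = "degree f"] sum_distrib_left)

lemma L_fun_sum: "L_fun a (\<Sum>x\<in>A. f x) = (\<Sum>x\<in>A. L_fun a (f x))"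
  by (induction A rule: infinite_finite_induct) (simp_all add: L_fun_add, simp_all add: L_fun_def)

lemma L_fun_monom: "L_fun a (monom r k) = r / Gamma (of_nat k + a + 1)"
proof -
  have "L_fun a (monom r k) = (\<Sum>j\<le>k. if j = k then r / Gamma (of_nat k + a + 1) else 0)"
    unfolding L_fun_bound[OF degree_monom_le] by (intro sum.cong) auto
  then show ?thesis by simp
qed

lemma B_inner_sum:
  fixes x :: complex
  assumes "\<And>k::nat. x + of_nat k \<noteq> 1"
  shows "(\<Sum>d=0..K. pochhammer (- of_nat K) d * rGamma (x + of_nat d))
           = rGamma x * (x - 1) / (x - 1 + of_nat K)"
  using assms
proof (induction K arbitrary: x)
  case 0
  from 0[of 0] show ?case by simp
next
  case (Suc K)
  have ne: "x + of_nat K \<noteq> 0" using Suc.prems[of "Suc K"] by (auto simp: add.commute)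
  have IH: "(\<Sum>d=0..K. pochhammer (- of_nat K) d * rGamma (x + 1 + of_nat d))
             = rGamma (x + 1) * x / (x + of_nat K)"
    using Suc.IH[of "x + 1"] Suc.prems[of "Suc _"] by (simp add: add_ac)
  have "(\<Sum>d=0..Suc K. pochhammer (- of_nat (Suc K)) d * rGamma (x + of_nat d))
      = rGamma x + (\<Sum>d=0..K. pochhammer (- of_nat (Suc K)) (Suc d) * rGamma (x + of_nat (Suc d)))"
    by (subst sum.atLeast0_atMost_Suc_shift) simp
  also have "(\<Sum>d=0..K. pochhammer (- of_nat (Suc K)) (Suc d) * rGamma (x + of_nat (Suc d)))
      = - of_nat (Suc K) * (\<Sum>d=0..K. pochhammer (- of_nat K) d * rGamma (x + 1 + of_nat d))"
    unfolding sum_distrib_left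
    by (intro sum.cong refl) (simp add: pochhammer_rec add_ac)
  also have "\<dots> = - of_nat (Suc K) * (rGamma x / (x + of_nat K))"
    unfolding IH using rGamma_plus1[of x] by (simp add: mult.commute)
  also have "rGamma x + \<dots> = rGamma x * (x - 1) / (x + of_nat K)"
    using ne by (simp add: divide_simps) (simp add: algebra_simps)
  finally show ?case by simp
qed

lemma alternating_sum_poly_eq_0:
  fixes q :: "complex poly"
  assumes "q = 0 \<or> degree q < N"
  shows "(\<Sum>K=0..N. (- 1) ^ K * of_nat (N choose K) * poly q (of_nat K)) = 0"
  using assms
proof (induction N arbitrary: q)
  case 0
  then show ?case by auto
next
  case (Suc N)
  define r where "r = pcompose q [:1, 1:] - q"
  have r: "poly r t = poly q (t + 1) - poly q t" for t
    by (simp add: r_def poly_pcompose add.commute)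
  have deg: "r = 0 \<or> degree r < N"
  proof (cases "degree q = 0")
    case True
    then obtain a where "q = [:a:]" by (meson degree_eq_zeroE)
    then show ?thesis by (simp add: r_def)
  next
    case False
    have d: "degree (pcompose q [:1, 1:]) = degree q" by (simp add: degree_pcompose)
    have lc: "lead_coeff (pcompose q [:1, 1:]) = lead_coeff q"
      by (subst lead_coeff_comp) auto
    have "degree r < degree q \<or> r = 0"
      using d lc False unfolding r_def
      by (metis (no_types, lifting) coeff_diff degree_diff_le eq_iff_diff_eq_0
          leading_coeff_0_iff order_le_less)
    then show ?thesis using Suc.prems by auto
  qed
  have "(\<Sum>K=0..Suc N. (- 1) ^ K * of_nat (Suc N choose K) * poly q (of_nat K))
      = poly q 0 + (\<Sum>K=0..N. (- 1) ^ Suc K * of_nat (Suc N choose Suc K) * poly q (of_nat (Suc K)))"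
    by (subst sum.atLeast0_atMost_Suc_shift) simp
  also have "\<dots> = (poly q 0 + (\<Sum>K=0..N. (- 1) ^ Suc K * of_nat (N choose Suc K) * poly q (of_nat (Suc K))))
       + (\<Sum>K=0..N. (- 1) ^ Suc K * of_nat (N choose K) * poly q (of_nat (Suc K)))"
    by (simp only: binomial_Suc_Suc of_nat_add ring_distribs sum.distrib add_ac)
  also have "poly q 0 + (\<Sum>K=0..N. (- 1) ^ Suc K * of_nat (N choose Suc K) * poly q (of_nat (Suc K)))
       = (\<Sum>K=0..Suc N. (- 1) ^ K * of_nat (N choose K) * poly q (of_nat K))"
    by (subst sum.atLeast0_atMost_Suc_shift) simp
  also have "\<dots> = (\<Sum>K=0..N. (- 1) ^ K * of_nat (N choose K) * poly q (of_nat K))"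
    by simp
  also have "\<dots> + (\<Sum>K=0..N. (- 1) ^ Suc K * of_nat (N choose K) * poly q (of_nat (Suc K)))
      = - (\<Sum>K=0..N. (- 1) ^ K * of_nat (N choose K) * poly r (of_nat K))"
    by (simp add: r sum_negf[symmetric] sum.distrib[symmetric] algebra_simps sum_subtractf)
  also have "\<dots> = 0" using Suc.IH[OF deg] by simp
  finally show ?case .
qed

lemma P_fun_nonzero:
  assumes "\<forall>i\<in>{1..p}. c i \<notin> \<int>\<^sub>\<le>\<^sub>0"
  shows "P_fun p c n (of_nat K) \<noteq> 0"
proof -
  have "c i + of_nat K \<noteq> - of_nat k" if "i \<in> {1..p}" for i k
  proof
    assume "c i + of_nat K = - of_nat k"
    then have "c i = - of_nat (K + k)" by (metis add_diff_cancel_right' diff_conv_add_uminus minus_add_distrib add.commute of_nat_add)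
    then show False using assms that by (metis minus_of_nat_in_nonpos_Ints)
  qed
  then show ?thesis by (auto simp: P_fun_def pochhammer_eq_0_iff)
qed

lemma coeff_B_poly:
  "coeff (B_poly p c n) d = (- (1 / P_fun p c n (of_nat (mi_size p n))))
     * (\<Sum>K=d..mi_size p n. B_weight p c n K * pochhammer (- of_nat K) d)"
proof -
  have "coeff (\<Sum>d=0..K. monom (pochhammer (- of_nat K) d) d) d
      = (if d \<le> K then pochhammer (- of_nat K :: complex) d else 0)" for K
    by (simp add: coeff_sum)
  then have inner: "B_weight p c n K * coeff (\<Sum>d=0..K. monom (pochhammer (- of_nat K) d) d) d
      = (if d \<le> K then B_weight p c n K * pochhammer (- of_nat K) d else 0)" for K
    by simp
  have "coeff (B_poly p c n) d = (- (1 / P_fun p c n (of_nat (mi_size p n))))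
     * (\<Sum>K=0..mi_size p n. if d \<le> K then B_weight p c n K * pochhammer (- of_nat K) d else 0)"
    unfolding B_poly_def coeff_smult coeff_sum[of _ "{0..mi_size p n}"] inner ..
  also have "(\<Sum>K=0..mi_size p n. if d \<le> K then B_weight p c n K * pochhammer (- of_nat K) d else 0)
     = (\<Sum>K=d..mi_size p n. B_weight p c n K * pochhammer (- of_nat K) d)"
    by (intro sum.mono_neutral_cong_right) auto
  finally show ?thesis .
qed

lemma B_poly_monic:
  assumes "\<forall>i\<in>{1..p}. c i \<notin> \<int>\<^sub>\<le>\<^sub>0"
  shows "degree (B_poly p c n) = mi_size p n" and "lead_coeff (B_poly p c n) = 1"
proof -
  let ?N = "mi_size p n"
  have "pochhammer (- of_nat ?N) ?N = (- 1) ^ ?N * (fact ?N :: complex)"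
    by (simp add: pochhammer_same)
  then have 1: "coeff (B_poly p c n) ?N = 1"
    using P_fun_nonzero[OF assms, of n ?N]
    by (simp add: coeff_B_poly B_weight_def)
  have "coeff (B_poly p c n) d = 0" if "d > ?N" for d
    using that by (simp add: coeff_B_poly)
  then have "degree (B_poly p c n) \<le> ?N" by (simp add: degree_le)
  then show 2: "degree (B_poly p c n) = ?N" using 1
    by (metis le_antisym le_degree zero_neq_one)
  show "lead_coeff (B_poly p c n) = 1" using 1 2 by simp
qed

lemma P_fun_factor:
  assumes "i \<in> {1..p}" and "l < n i"
  obtains q where "degree q < mi_size p n"
    and "\<And>t. P_fun p c n t = (c i + of_nat l + t) * poly q t"
proof -
  define f where "f j k = [:c j + of_nat k, 1:]" for j k
  define q where "q = (\<Prod>k\<in>{0..<n i} - {l}. f i k) * (\<Prod>j\<in>{1..p} - {i}. \<Prod>k=0..<n j. f j k)"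
  have "P_fun p c n t = (\<Prod>j=1..p. \<Prod>k=0..<n j. poly (f j k) t)" for t
    by (simp add: P_fun_def pochhammer_prod f_def add_ac)
  also have "\<dots> t = (\<Prod>k=0..<n i. poly (f i k) t) * (\<Prod>j\<in>{1..p} - {i}. \<Prod>k=0..<n j. poly (f j k) t)" for t
    using assms(1) by (intro prod.remove) auto
  also have "\<dots> t = poly (f i l) t * (\<Prod>k\<in>{0..<n i} - {l}. poly (f i k) t) * (\<Prod>j\<in>{1..p} - {i}. \<Prod>k=0..<n j. poly (f j k) t)" for t
    using assms(2) by (subst prod.remove[of _ l]) auto
  finally have "P_fun p c n t = (c i + of_nat l + t) * poly q t" for t
    by (simp add: q_def poly_prod f_def algebra_simps)
  moreover have "degree q < mi_size p n"
  proof -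
    have "degree q \<le> (\<Sum>k\<in>{0..<n i} - {l}. 1) + (\<Sum>j\<in>{1..p} - {i}. \<Sum>k=0..<n j. 1)"
    proof -
      have f: "degree (f j k) = 1" for j k by (simp add: f_def)
      have "degree (\<Prod>k\<in>{0..<n i} - {l}. f i k) \<le> (\<Sum>k\<in>{0..<n i} - {l}. 1)"
        using degree_prod_sum_le[of "{0..<n i} - {l}" "f i"] by (simp add: f o_def)
      moreover have "degree (\<Prod>k=0..<n j. f j k) \<le> n j" for j
        using degree_prod_sum_le[of "{0..<n j}" "f j"] by (simp add: f o_def)
      then have "degree (\<Prod>j\<in>{1..p} - {i}. \<Prod>k=0..<n j. f j k) \<le> (\<Sum>j\<in>{1..p} - {i}. n j)"
        using degree_prod_sum_le[of "{1..p} - {i}" "\<lambda>j. \<Prod>k=0..<n j. f j k"]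
        by (auto simp: o_def intro: order.trans[OF _ sum_mono])
      ultimately show ?thesis
        unfolding q_def by (intro order.trans[OF degree_mult_le]) (auto intro!: add_mono)
    qed
    also have "\<dots> < n i + (\<Sum>j\<in>{1..p} - {i}. n j)" using assms(2) by simp
    also have "\<dots> = mi_size p n"
      unfolding mi_size_def using assms(1) by (subst sum.remove[of _ i]) auto
    finally show ?thesis .
  qed
  ultimately show ?thesis using that by blast
qed

lemma B_poly_orthogonal:
  assumes c: "\<forall>i\<in>{1..p}. c i \<notin> \<int>\<^sub>\<le>\<^sub>0" and i: "i \<in> {1..p}" and l: "l < n i"
  shows "L_fun (c i) (monom 1 l * B_poly p c n) = 0"
proof -
  let ?N = "mi_size p n"
  obtain q where q: "degree q < ?N" "\<And>t. P_fun p c n t = (c i + of_nat l + t) * poly q t"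
    using P_fun_factor[where p = p and n = n and c = c, OF i l] by metis
  define x where "x = c i + of_nat l + 1"
  have ne: "c i + of_nat k \<noteq> 0" for k
    using c i by (metis add_eq_0_iff2 minus_of_nat_in_nonpos_Ints)
  have nex: "x + of_nat k \<noteq> 1" for k
    using ne[of "l + k"] by (auto simp: x_def algebra_simps)
  have "L_fun (c i) (monom 1 l * B_poly p c n)
      = - (1 / P_fun p c n (of_nat ?N)) * (\<Sum>K=0..?N. B_weight p c n K *
           (\<Sum>d=0..K. pochhammer (- of_nat K) d * rGamma (x + of_nat d)))"
    unfolding B_poly_def mult_smult_right sum_distrib_left L_fun_smult L_fun_sum mult_monom
      L_fun_monom
    by (simp add: rGamma_inverse_Gamma x_def field_simps add_ac sum_distrib_left)
  also have "\<dots> = - (1 / P_fun p c n (of_nat ?N)) * (\<Sum>K=0..?N. 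
      - (rGamma x * (x - 1) / fact ?N) * ((- 1) ^ K * of_nat (?N choose K) * poly q (of_nat K)))"
  proof (rule arg_cong2[where f = "(*)", OF refl], rule sum.cong[OF refl])
    fix K assume K: "K \<in> {0..?N}"
    have "x - 1 + of_nat K \<noteq> 0" using nex[of K] by (simp add: algebra_simps)
    moreover have "of_nat (?N choose K) = (fact ?N / (fact K * fact (?N - K)) :: complex)"
      using K by (simp add: binomial_fact)
    moreover have "P_fun p c n (of_nat K) = (x - 1 + of_nat K) * poly q (of_nat K)"
      by (simp add: q x_def)
    ultimately have "B_weight p c n K * (rGamma x * (x - 1) / (x - 1 + of_nat K))
       = - (rGamma x * (x - 1) / fact ?N) * ((- 1) ^ K * of_nat (?N choose K) * poly q (of_nat K))"
      unfolding B_weight_def by (cases "even K") simp_all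
    then show "B_weight p c n K * (\<Sum>d=0..K. pochhammer (- of_nat K) d * rGamma (x + of_nat d))
       = - (rGamma x * (x - 1) / fact ?N) * ((- 1) ^ K * of_nat (?N choose K) * poly q (of_nat K))"
      by (simp only: B_inner_sum[OF nex])
  qed
  also have "\<dots> = 0"
    unfolding sum_distrib_left[symmetric] using alternating_sum_poly_eq_0[of q ?N] q(1) by simp
  finally show ?thesis .
qed

end

theory Submission
  imports Defs
begin

text \<open>
  Up to elementary factors, the coefficient of \<open>z\<^sup>d\<close> in both polynomials is the finite
  difference \<open>\<Delta>\<^bsup>N-d\<^esup> P(d)\<close>. Writing \<open>P(t) = (c\<^sub>* + t)\<^bsub>n\<^sub>*\<^esub> S\<^sub>*(t)\<close> and applying the discrete Leibniz rule
  gives \<open>\<Delta>\<^bsup>N-d\<^esup> P(d) = (n\<^sub>*! / d!) (c\<^sub>* + n\<^sub>*)\<^sub>d Q(d)\<close>, and factoring \<open>Q\<close> over its zeros turns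
  \<open>Q(d) / Q(0)\<close> into \<open>\<Prod>\<^sub>l (d - \<xi>\<^sub>l) / (- \<xi>\<^sub>l)\<close>. The leading coefficient of \<open>Q\<close> is Newton's backward
  difference expansion of \<open>S\<^sub>*\<close> at \<open>N\<close>, evaluated at \<open>1 - c\<^sub>*\<close>.
\<close>

section \<open>Calculus of iterated forward differences\<close>

text \<open>Pascal's rule in operator form: (1 + E)^(M+1) = (1 + E)^M (1 + E) for the index shift E.
  It is the induction step of every binomial expansion below; each time the summand has to be
  brought to the shape \<open>T i + T (Suc i)\<close>.\<close>

lemma sum_choose_Suc:
  fixes T :: "nat \<Rightarrow> 'a::comm_semiring_1"
  shows "(\<Sum>i\<le>Suc M. of_nat (Suc M choose i) * T i)
       = (\<Sum>i\<le>M. of_nat (M choose i) * (T i + T (Suc i)))"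
proof -
  have "(\<Sum>i\<le>Suc M. of_nat (Suc M choose i) * T i)
      = T 0 + (\<Sum>i\<le>M. of_nat (Suc M choose Suc i) * T (Suc i))"
    by (subst sum.atMost_Suc_shift) simp
  also have "\<dots> = (T 0 + (\<Sum>i\<le>M. of_nat (M choose Suc i) * T (Suc i)))
      + (\<Sum>i\<le>M. of_nat (M choose i) * T (Suc i))"
    by (simp only: binomial_Suc_Suc of_nat_add ring_distribs sum.distrib add_ac)
  also have "T 0 + (\<Sum>i\<le>M. of_nat (M choose Suc i) * T (Suc i))
      = (\<Sum>i\<le>Suc M. of_nat (M choose i) * T i)"
    by (subst sum.atMost_Suc_shift) simp
  also have "\<dots> = (\<Sum>i\<le>M. of_nat (M choose i) * T i)"
    by (simp add: binomial_eq_0)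
  finally show ?thesis
    by (simp add: sum.distrib[symmetric] algebra_simps)
qed

lemma fwd_diff_funpow_Suc:
  "(fwd_diff ^^ Suc k) F t = (fwd_diff ^^ k) F (t + 1) - (fwd_diff ^^ k) F t"
  by (simp add: fwd_diff_def)

text \<open>The binomial expansion of (E - 1)^M, with E the unit shift of the argument.\<close>

lemma fwd_diff_funpow_explicit:
  "(fwd_diff ^^ M) F t = (\<Sum>k\<le>M. of_nat (M choose k) * ((- 1) ^ (M - k) * F (t + of_nat k)))"
proof (induction M arbitrary: t)
  case (Suc M)
  have "(fwd_diff ^^ Suc M) F t = (\<Sum>k\<le>M. of_nat (M choose k) *
      ((- 1) ^ (M - k) * F (t + 1 + of_nat k) - (- 1) ^ (M - k) * F (t + of_nat k)))"
    unfolding fwd_diff_funpow_Suc Suc.IH by (simp add: sum_subtractf algebra_simps)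
  also have "\<dots> = (\<Sum>k\<le>M. of_nat (M choose k) *
      ((- 1) ^ (Suc M - k) * F (t + of_nat k) + (- 1) ^ (Suc M - Suc k) * F (t + of_nat (Suc k))))"
    by (intro sum.cong refl) (simp add: Suc_diff_le add_ac)
  finally show ?case
    by (simp only: sum_choose_Suc[where T = "\<lambda>k. (- 1) ^ (Suc M - k) * F (t + of_nat k)"])
qed simp

text \<open>Iterates the asymmetric product rule \<Delta>(u v)(t) = \<Delta>u(t) v(t+1) + u(t)
  \<Delta>v(t). Each difference that falls on \<open>f\<close> advances the argument of
  \<open>g\<close> by one, hence the shift \<open>M - i\<close>.\<close>

lemma fwd_diff_funpow_mult:
  "(fwd_diff ^^ M) (\<lambda>t. f t * g t) t
     = (\<Sum>i\<le>M. of_nat (M choose i) *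
          ((fwd_diff ^^ (M - i)) f t * (fwd_diff ^^ i) g (t + of_nat (M - i))))"
proof (induction M arbitrary: t)
  case (Suc M)
  have "(fwd_diff ^^ Suc M) (\<lambda>t. f t * g t) t
      = (\<Sum>i\<le>M. of_nat (M choose i) *
          ((fwd_diff ^^ (M - i)) f (t + 1) * (fwd_diff ^^ i) g (t + 1 + of_nat (M - i))
           - (fwd_diff ^^ (M - i)) f t * (fwd_diff ^^ i) g (t + of_nat (M - i))))"
    unfolding fwd_diff_funpow_Suc Suc.IH by (simp add: sum_subtractf algebra_simps)
  also have "\<dots> = (\<Sum>i\<le>M. of_nat (M choose i) *
          ((fwd_diff ^^ (Suc M - i)) f t * (fwd_diff ^^ i) g (t + of_nat (Suc M - i))
           + (fwd_diff ^^ (Suc M - Suc i)) f t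
               * (fwd_diff ^^ Suc i) g (t + of_nat (Suc M - Suc i))))"
  proof (intro sum.cong refl arg_cong2[where f = "(*)"])
    fix i assume "i \<in> {..M}"
    then have 1: "t + 1 + of_nat (M - i) = t + of_nat (M - i) + 1" "Suc M - i = Suc (M - i)"
      "t + of_nat (Suc M - i) = t + of_nat (M - i) + 1"
      by (auto simp: Suc_diff_le)
    show "(fwd_diff ^^ (M - i)) f (t + 1) * (fwd_diff ^^ i) g (t + 1 + of_nat (M - i))
           - (fwd_diff ^^ (M - i)) f t * (fwd_diff ^^ i) g (t + of_nat (M - i))
        = (fwd_diff ^^ (Suc M - i)) f t * (fwd_diff ^^ i) g (t + of_nat (Suc M - i))
           + (fwd_diff ^^ (Suc M - Suc i)) f t
               * (fwd_diff ^^ Suc i) g (t + of_nat (Suc M - Suc i))"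
      unfolding 1 diff_Suc_Suc fwd_diff_funpow_Suc by (simp add: algebra_simps)
  qed
  finally show ?case
    by (simp only: sum_choose_Suc[where
      T = "\<lambda>i. (fwd_diff ^^ (Suc M - i)) f t * (fwd_diff ^^ i) g (t + of_nat (Suc M - i))"])
qed simp

text \<open>The Leibniz rule for the identity function, whose differences beyond the first vanish.
  It handles the Horner step of \<open>fwd_diff_funpow_poly\<close>.\<close>

lemma fwd_diff_funpow_times_id:
  "(fwd_diff ^^ Suc k) (\<lambda>t. t * h t) t
     = t * (fwd_diff ^^ Suc k) h t + of_nat (Suc k) * (fwd_diff ^^ k) h (t + 1)"
proof (induction k arbitrary: t)
  case 0
  then show ?case by (simp add: fwd_diff_def algebra_simps)
next
  case (Suc k)
  show ?case
    unfolding fwd_diff_funpow_Suc[of "Suc k"] Suc.IH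
    unfolding fwd_diff_funpow_Suc[of k]
    by (simp add: algebra_simps)
qed

lemma fwd_diff_funpow_const_add:
  "(fwd_diff ^^ Suc k) (\<lambda>t. a + h t) t = (fwd_diff ^^ Suc k) h t"
  by (induction k arbitrary: t) (simp add: fwd_diff_def, simp only: fwd_diff_funpow_Suc[of "Suc _"])

text \<open>Induction on the Horner form a + t q(t). Stating the value with \<open>coeff q k\<close>
  covers both the leading coefficient, for degree k, and the vanishing above the degree.\<close>

lemma fwd_diff_funpow_poly:
  "degree q \<le> k \<Longrightarrow> (fwd_diff ^^ k) (poly q) t = fact k * coeff q k"
proof (induction q arbitrary: k t)
  case 0
  then show ?case by (simp add: fwd_diff_funpow_explicit)
next
  case (pCons a q)
  show ?case
  proof (cases k)
    case 0
    then show ?thesis using pCons by (auto split: if_splits)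
  next
    case (Suc j)
    have deg: "degree q \<le> j" using pCons.prems Suc by (auto split: if_splits)
    \<comment> \<open>The difference of order \<open>j\<close> is constant by the induction
      hypothesis, so one more difference kills it.\<close>
    have *: "(fwd_diff ^^ Suc j) (poly q) t = 0"
      using pCons.IH[of j] deg by (simp only: fwd_diff_funpow_Suc) simp
    have eq: "poly (pCons a q) = (\<lambda>t. a + t * poly q t)"
      by (simp add: fun_eq_iff)
    show ?thesis
      unfolding Suc eq fwd_diff_funpow_const_add fwd_diff_funpow_times_id * pCons.IH[OF deg]
      by (simp add: algebra_simps)
  qed
qed

lemma fwd_diff_funpow_poly_eq_0:
  "degree q < k \<Longrightarrow> (fwd_diff ^^ k) (poly q) t = 0"
  by (simp add: fwd_diff_funpow_poly coeff_eq_0)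

text \<open>Each difference sends (x)_r to r (x+1)_(r-1). The accumulated factor k!/(k-j)! is
  written with a binomial coefficient so that it vanishes for j > k.\<close>

lemma fwd_diff_funpow_pochhammer:
  "(fwd_diff ^^ j) (\<lambda>t. pochhammer (a + t) k) t
     = of_nat (k choose j) * fact j * pochhammer (a + t + of_nat j) (k - j)"
proof (induction j arbitrary: t)
  case (Suc j)
  show ?case
  proof (cases "k - j")
    case 0
    then show ?thesis unfolding fwd_diff_funpow_Suc Suc.IH by (simp add: binomial_eq_0)
  next
    case (Suc r)
    have *: "k - Suc j = r" using Suc by simp
    have "(k choose Suc j) * Suc j = (k choose j) * (k - j)"
      using binomial_absorb_comp[of k j] binomial_absorption[of j k] by (simp add: mult.commute)
    then have "(of_nat (k choose Suc j) * of_nat (Suc j) :: complex) = of_nat (k choose j) * of_nat (Suc r)"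
      by (metis Suc of_nat_mult)
    then have b: "of_nat (k choose Suc j) * fact (Suc j)
       = of_nat (k choose j) * fact j * (of_nat (Suc r) :: complex)"
      by (simp add: algebra_simps del: of_nat_Suc)
    show ?thesis
      unfolding fwd_diff_funpow_Suc Suc.IH Suc b *
      \<comment> \<open>Both terms share the factor (x+1)_r: it is (x)_(r+1) without its first
        factor x, and (x+1)_(r+1) without its last factor x+1+r.\<close>
      unfolding pochhammer_rec[of "a + t + of_nat j" r] pochhammer_Suc[of "a + (t + 1) + of_nat j"]
      by (simp add: algebra_simps)
  qed
qed simp

section \<open>Newton's backward difference expansion\<close>

text \<open>In terms of the shift \<open>E\<close>, this is \<open>(1 - \<Delta> E\<^bsup>-1\<^esup>)\<^bsup>k\<^esup> = E\<^bsup>-k\<^esup>\<close>.\<close>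

lemma backward_newton_nat:
  "(\<Sum>i\<le>k. of_nat (k choose i) * ((- 1) ^ i * (fwd_diff ^^ i) F (t - of_nat i))) = F (t - of_nat k)"
proof (induction k arbitrary: t)
  case (Suc k)
  have "(\<Sum>i\<le>Suc k. of_nat (Suc k choose i) * ((- 1) ^ i * (fwd_diff ^^ i) F (t - of_nat i)))
      = (\<Sum>i\<le>k. of_nat (k choose i) * ((- 1) ^ i * (fwd_diff ^^ i) F (t - of_nat i)
           + (- 1) ^ Suc i * (fwd_diff ^^ Suc i) F (t - of_nat (Suc i))))"
    by (rule sum_choose_Suc)
  also have "\<dots> = (\<Sum>i\<le>k. of_nat (k choose i) * ((- 1) ^ i * (fwd_diff ^^ i) F (t - 1 - of_nat i)))"
    unfolding fwd_diff_funpow_Suc by (intro sum.cong refl) (simp add: algebra_simps)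
  also have "\<dots> = F (t - of_nat (Suc k))"
    unfolding Suc.IH by (simp add: algebra_simps)
  finally show ?case .
qed simp

lemma poly_pochhammer: "poly (pochhammer q k) x = pochhammer (poly q x) k"
  by (simp add: pochhammer_prod poly_prod)

text \<open>Both sides are polynomials in \<open>x\<close>. They agree at every x = -k by
  \<open>backward_newton_nat\<close>, hence at infinitely many points, hence everywhere.\<close>

lemma backward_newton_poly:
  fixes q :: "complex poly"
  assumes "degree q \<le> m"
  shows "(\<Sum>i\<le>m. pochhammer x i / fact i * (fwd_diff ^^ i) (poly q) (t - of_nat i)) = poly q (t + x)"
proof -
  define A where "A = (\<Sum>i\<le>m. smult ((fwd_diff ^^ i) (poly q) (t - of_nat i) / fact i)
     (pochhammer [:0, 1:] i)) - pcompose q [:t, 1:]"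
  have A: "poly A y = (\<Sum>i\<le>m. pochhammer y i / fact i * (fwd_diff ^^ i) (poly q) (t - of_nat i))
      - poly q (t + y)" for y
    by (simp add: A_def poly_sum poly_pochhammer poly_pcompose mult.commute)
  have "poly A (- of_nat k) = 0" for k
  proof -
    have "(\<Sum>i\<le>m. pochhammer (- of_nat k) i / fact i * (fwd_diff ^^ i) (poly q) (t - of_nat i))
        = (\<Sum>i\<le>m. of_nat (k choose i) * ((- 1) ^ i * (fwd_diff ^^ i) (poly q) (t - of_nat i)))"
      by (intro sum.cong refl)
         (simp add: binomial_gbinomial gbinomial_pochhammer[of "of_nat k :: complex"] flip: power_add)
    \<comment> \<open>The ranges may be exchanged: terms with i > k vanish by the binomial
      coefficient, terms with i > m by the degree of \<open>q\<close>.\<close>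
    also have "\<dots> = (\<Sum>i\<le>k. of_nat (k choose i) * ((- 1) ^ i * (fwd_diff ^^ i) (poly q) (t - of_nat i)))"
      using assms by (intro sum.mono_neutral_cong) (auto simp: fwd_diff_funpow_poly_eq_0 binomial_eq_0)
    also have "\<dots> = poly q (t - of_nat k)" by (rule backward_newton_nat)
    finally show ?thesis by (simp add: A)
  qed
  then have "range (\<lambda>k::nat. - of_nat k :: complex) \<subseteq> {y. poly A y = 0}" by auto
  moreover have "infinite (range (\<lambda>k::nat. - of_nat k :: complex))"
    by (rule range_inj_infinite) (auto intro: injI)
  ultimately have "A = 0" using poly_roots_finite finite_subset by blast
  then show ?thesis using A[of x] by simp
qed

section \<open>Degrees of Pochhammer polynomials; values and leading coefficient of
  \<open>Q_poly\<close>\<close>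

lemma lead_coeff_pochhammer_linear:
  fixes a b :: complex
  assumes "b \<noteq> 0"
  shows "lead_coeff (pochhammer [:a, b:] k) = b ^ k"
proof (induction k)
  case (Suc k)
  have *: "[:a, b:] + of_nat k = [:a + of_nat k, b:]" by (simp add: of_nat_poly)
  show ?case
    unfolding pochhammer_Suc * lead_coeff_mult Suc using assms by simp
qed simp

lemma pochhammer_linear_nonzero:
  fixes a b :: complex
  assumes "b \<noteq> 0"
  shows "pochhammer [:a, b:] k \<noteq> 0"
  using lead_coeff_pochhammer_linear[OF assms, of a k] assms by auto

lemma degree_pochhammer_linear:
  fixes a b :: complex
  assumes "b \<noteq> 0"
  shows "degree (pochhammer [:a, b:] k) = k"
proof (induction k)
  case (Suc k)
  have *: "[:a, b:] + of_nat k = [:a + of_nat k, b:]" by (simp add: of_nat_poly)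
  show ?case
    unfolding pochhammer_Suc * using assms Suc
    by (subst degree_mult_eq[OF pochhammer_linear_nonzero]) auto
qed simp

text \<open>Makes the difference results for polynomials applicable to the function
  \<open>S_fun\<close>; being monic fixes its top difference, which is the factorial of its
  degree.\<close>

lemma S_fun_poly:
  assumes "s \<in> {1..p}"
  obtains q where "S_fun p c n s = poly q" "degree q = mi_size p n - n s"
    "coeff q (mi_size p n - n s) = 1"
proof -
  define q where "q = (\<Prod>i\<in>{1..p} - {s}. pochhammer [:c i, 1:] (n i))"
  have "mi_size p n = n s + (\<Sum>i\<in>{1..p} - {s}. n i)"
    unfolding mi_size_def using assms by (intro sum.remove) auto
  then have deg: "degree q = mi_size p n - n s"
    unfolding q_def
    by (subst degree_prod_eq_sum_degree)
       (simp_all add: pochhammer_linear_nonzero degree_pochhammer_linear)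
  moreover have "lead_coeff q = 1"
    unfolding q_def lead_coeff_prod
    by (intro prod.neutral ballI, subst lead_coeff_pochhammer_linear) auto
  moreover have "S_fun p c n s = poly q"
    by (simp add: fun_eq_iff S_fun_def q_def poly_prod poly_pochhammer)
  ultimately show ?thesis using that by simp
qed

lemma P_fun_eq_S_fun:
  assumes "s \<in> {1..p}"
  shows "P_fun p c n t = pochhammer (c s + t) (n s) * S_fun p c n s t"
  unfolding P_fun_def S_fun_def using assms by (intro prod.remove) auto

lemma mi_size_ge: "s \<in> {1..p} \<Longrightarrow> n s \<le> mi_size p n"
  unfolding mi_size_def by (rule member_le_sum) auto

text \<open>
  With \<open>i = m - j\<close>, the second Pochhammer factor of \<open>Q\<close> is a generalised binomial coefficient; at
  \<open>x = d\<close> it is the coefficient \<open>N - d choose i\<close> of the Leibniz rule.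
\<close>

lemma poly_Q_poly:
  assumes "m = mi_size p n - n s"
  shows "poly (Q_poly p c n s) x =
    (\<Sum>i\<le>m. (- 1) ^ (m - i) * pochhammer (- x) (m - i) / pochhammer (c s + of_nat (n s)) (m - i)
       * ((of_nat (n s + m) - x) gchoose i)
       * (fwd_diff ^^ i) (S_fun p c n s) (of_nat (n s + m - i)))"
proof -
  have "poly (Q_poly p c n s) x = (\<Sum>j\<le>m. (- 1) ^ j * pochhammer (- x) j
       / pochhammer (c s + of_nat (n s)) j * ((of_nat (n s + m) - x) gchoose (m - j))
       * (fwd_diff ^^ (m - j)) (S_fun p c n s) (of_nat (n s + j)))"
    unfolding Q_poly_def assms[symmetric] Let_def poly_sum
    by (intro sum.cong)
       (auto simp: poly_pochhammer gbinomial_pochhammer' of_nat_diff algebra_simps)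
  also have "\<dots> = (\<Sum>i\<le>m. (- 1) ^ (m - i) * pochhammer (- x) (m - i)
       / pochhammer (c s + of_nat (n s)) (m - i) * ((of_nat (n s + m) - x) gchoose (m - (m - i)))
       * (fwd_diff ^^ (m - (m - i))) (S_fun p c n s) (of_nat (n s + (m - i))))"
    by (rule sum.reindex_bij_witness[of _ "\<lambda>i. m - i" "\<lambda>i. m - i"]) auto
  finally show ?thesis by simp
qed

lemma fwd_diff_P_fun:
  assumes s: "s \<in> {1..p}" and c: "c s + of_nat (n s) \<notin> \<int>\<^sub>\<le>\<^sub>0"
    and N: "N = mi_size p n" and d: "d \<le> N"
  shows "(fwd_diff ^^ (N - d)) (P_fun p c n) (of_nat d)
     = fact (n s) / fact d * pochhammer (c s + of_nat (n s)) d * poly (Q_poly p c n s) (of_nat d)"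
proof -
  define m where "m = N - n s"
  define S where "S = S_fun p c n s"
  define a where "a = c s + of_nat (n s)"
  have a: "pochhammer a k \<noteq> 0" for k
    using c unfolding a_def pochhammer_eq_0_iff by auto
  have Nm: "N = n s + m" using mi_size_ge[OF s, of n] by (simp add: m_def N)
  obtain q where q: "S = poly q" "degree q = m"
    using S_fun_poly[OF s, of c n] unfolding S_def m_def N by metis
  have "(fwd_diff ^^ (N - d)) (P_fun p c n) (of_nat d)
      = (\<Sum>i\<le>N - d. of_nat (N - d choose i) * ((fwd_diff ^^ (N - d - i))
          (\<lambda>t. pochhammer (c s + t) (n s)) (of_nat d)
          * (fwd_diff ^^ i) S (of_nat d + of_nat (N - d - i))))"
    unfolding P_fun_eq_S_fun[OF s] S_def[symmetric] by (rule fwd_diff_funpow_mult)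
  \<comment> \<open>The Leibniz terms with i > m vanish because S has degree m, and those on the
    right with i > N - d because of the binomial coefficient. The remaining terms agree one by
    one.\<close>
  also have "\<dots> = (\<Sum>i\<le>m. fact (n s) / fact d * pochhammer a d *
      ((- 1) ^ (m - i) * pochhammer (- of_nat d) (m - i) / pochhammer a (m - i)
        * of_nat (N - d choose i) * (fwd_diff ^^ i) S (of_nat (N - i))))"
  proof (intro sum.mono_neutral_cong)
    fix i assume i: "i \<in> {..N - d} \<inter> {..m}"
    \<comment> \<open>\<open>e\<close> counts the differences falling on the Pochhammer factor, and
      \<open>j\<close> is the summation index of \<open>Q_poly\<close>. As e + d = n s + j, the
      conditions e \<le> n s and j \<le> d are equivalent.\<close>
    define e where "e = N - d - i"
    define j where "j = m - i"
    have e: "e + d = n s + j" using i d unfolding e_def j_def Nm by auto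
    have arg: "of_nat d + of_nat e = (of_nat (N - i) :: complex)"
      using i d unfolding e_def of_nat_add[symmetric] by (intro arg_cong[of _ _ of_nat]) auto
    have "(fwd_diff ^^ e) (\<lambda>t. pochhammer (c s + t) (n s)) (of_nat d)
        = fact (n s) / fact d * pochhammer a d *
           ((- 1) ^ j * pochhammer (- of_nat d) j / pochhammer a j)"
    proof (cases "e \<le> n s")
      case True
      have jd: "j \<le> d" "n s - e = d - j" using True e by auto
      \<comment> \<open>The differenced factor is (a+j)_(d-j), the tail of (a)_d, which produces the
        quotient (a)_d / (a)_j.\<close>
      have "pochhammer a d = pochhammer a j * pochhammer (a + of_nat j) (d - j)"
        using jd by (simp add: pochhammer_product)
      moreover have "c s + of_nat d + of_nat e = a + of_nat j"
        using arg_cong[OF e, of "of_nat :: nat \<Rightarrow> complex"] by (simp add: a_def add_ac)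
      moreover have "(of_nat (n s choose e) * fact e :: complex) = fact (n s) / fact (d - j)"
        using True by (simp add: binomial_fact jd(2))
      moreover have "(- 1) ^ j * pochhammer (- of_nat d) j = (fact d / fact (d - j) :: complex)"
      proof -
        have "(- 1) ^ j * pochhammer (- of_nat d) j = (of_nat (d choose j) * fact j :: complex)"
          by (simp add: binomial_gbinomial gbinomial_pochhammer[of "of_nat d :: complex"])
        then show ?thesis using jd by (simp add: binomial_fact)
      qed
      ultimately show ?thesis
        using a[of j] by (simp add: fwd_diff_funpow_pochhammer jd(2))
    next
      case False
      \<comment> \<open>Both sides are zero: more than \<open>n s\<close> differences kill the
        Pochhammer factor, and (-d)_j contains the factor 0.\<close>
      then have "j > d" using e by auto
      then show ?thesis using False
        by (simp add: fwd_diff_funpow_pochhammer binomial_eq_0 pochhammer_of_nat_eq_0_iff)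
    qed
    then show "of_nat (N - d choose i) * ((fwd_diff ^^ (N - d - i))
          (\<lambda>t. pochhammer (c s + t) (n s)) (of_nat d)
          * (fwd_diff ^^ i) S (of_nat d + of_nat (N - d - i)))
       = fact (n s) / fact d * pochhammer a d *
          ((- 1) ^ (m - i) * pochhammer (- of_nat d) (m - i) / pochhammer a (m - i)
          * of_nat (N - d choose i) * (fwd_diff ^^ i) S (of_nat (N - i)))"
      unfolding e_def[symmetric] j_def[symmetric] arg by simp
  next
    fix i assume "i \<in> {..N - d} - {..m}"
    then show "of_nat (N - d choose i) * ((fwd_diff ^^ (N - d - i))
          (\<lambda>t. pochhammer (c s + t) (n s)) (of_nat d)
          * (fwd_diff ^^ i) S (of_nat d + of_nat (N - d - i))) = 0"
      using q by (simp add: fwd_diff_funpow_poly_eq_0)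
  qed (auto simp: binomial_eq_0)
  also have "\<dots> = fact (n s) / fact d * pochhammer a d * poly (Q_poly p c n s) (of_nat d)"
    unfolding poly_Q_poly[OF m_def[unfolded N]] sum_distrib_left[symmetric]
    unfolding N[symmetric] m_def[symmetric] a_def[symmetric] S_def[symmetric] Nm[symmetric]
    using d by (simp add: binomial_gbinomial of_nat_diff)
  finally show ?thesis unfolding a_def .
qed

text \<open>At 0 the factor (-x)_j leaves only j = 0, that is i = m. There the difference of the
  monic \<open>S_fun\<close> is m!, and the binomial coefficient is N choose m.\<close>

lemma poly_Q_poly_0:
  assumes s: "s \<in> {1..p}"
  shows "poly (Q_poly p c n s) 0 = fact (mi_size p n) / fact (n s)"
proof -
  define m where "m = mi_size p n - n s"
  obtain q where q: "S_fun p c n s = poly q" "degree q = m" "coeff q m = 1"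
    using S_fun_poly[OF s, of c n] unfolding m_def by metis
  have Nm: "mi_size p n = n s + m" using mi_size_ge[OF s, of n] by (simp add: m_def)
  have "poly (Q_poly p c n s) 0 =
    (\<Sum>i\<le>m. if i = m then (of_nat (n s + m) gchoose m) * (fwd_diff ^^ m) (poly q) (of_nat (n s)) else 0)"
    unfolding poly_Q_poly[OF m_def] q(1) by (intro sum.cong) (auto simp: pochhammer_0_left)
  also have "\<dots> = of_nat (n s + m choose m) * fact m"
    using q by (simp add: fwd_diff_funpow_poly binomial_gbinomial)
  finally show ?thesis by (simp add: binomial_fact Nm)
qed

text \<open>Every summand polynomial has degree m and leading coefficient (-1)^m, whatever j is, so
  the top coefficient is a sum of the weights. Only an upper bound for the degree follows here,
  since this coefficient may vanish.\<close>

lemma Q_poly_degree_coeff: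
  assumes s: "s \<in> {1..p}" and c: "c s + of_nat (n s) \<notin> \<int>\<^sub>\<le>\<^sub>0" and m: "m = mi_size p n - n s"
  shows "degree (Q_poly p c n s) \<le> m"
    and "coeff (Q_poly p c n s) m = S_fun p c n s (1 - c s) / pochhammer (c s + of_nat (n s)) m"
proof -
  define a where "a = c s + of_nat (n s)"
  have a: "pochhammer a k \<noteq> 0" for k
    using c unfolding a_def pochhammer_eq_0_iff by auto
  obtain q where q: "S_fun p c n s = poly q" "degree q = m"
    using S_fun_poly[OF s, of c n] unfolding m by metis
  define w where "w j = (- 1) ^ j / (pochhammer a j * fact (m - j))
                 * (fwd_diff ^^ (m - j)) (poly q) (of_nat (n s + j))" for j
  define f :: "nat \<Rightarrow> complex poly"
    where "f j = pochhammer [:0, - 1:] j * pochhammer [:of_nat (n s + j + 1), - 1:] (m - j)" for j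
  have Q: "Q_poly p c n s = (\<Sum>j\<le>m. smult (w j) (f j))"
    unfolding Q_poly_def m[symmetric] Let_def w_def f_def q(1) a_def atMost_atLeast0 ..
  have f: "degree (f j) = m" "coeff (f j) m = (- 1) ^ m" if "j \<le> m" for j
  proof -
    let ?g = "pochhammer [:0, - 1:] j :: complex poly"
    let ?h = "pochhammer [:of_nat (n s + j + 1), - 1:] (m - j) :: complex poly"
    have g: "degree ?g = j" "lead_coeff ?g = (- 1) ^ j"
      by (rule degree_pochhammer_linear lead_coeff_pochhammer_linear; simp)+
    have h: "degree ?h = m - j" "lead_coeff ?h = (- 1) ^ (m - j)"
      by (rule degree_pochhammer_linear lead_coeff_pochhammer_linear; simp)+
    have "?g \<noteq> 0" "?h \<noteq> 0" using g(2) h(2) by auto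
    then show d: "degree (f j) = m" unfolding f_def using that g(1) h(1) by (subst degree_mult_eq) auto
    have "lead_coeff (f j) = (- 1) ^ j * (- 1) ^ (m - j)"
      unfolding f_def lead_coeff_mult g(2) h(2) ..
    then show "coeff (f j) m = (- 1) ^ m" using d that by (simp flip: power_add)
  qed
  show "degree (Q_poly p c n s) \<le> m"
    unfolding Q using f(1) by (intro degree_sum_le) (auto intro: order.trans[OF degree_smult_le])
  have "coeff (Q_poly p c n s) m = (\<Sum>j\<le>m. w j * (- 1) ^ m)"
    unfolding Q by (simp add: coeff_sum f)
  also have "\<dots> = (\<Sum>i\<le>m. w (m - i) * (- 1) ^ m)"
    by (rule sum.reindex_bij_witness[of _ "\<lambda>i. m - i" "\<lambda>i. m - i"]) auto
  \<comment> \<open>The quotient (a)_m / (a)_(m-i) = (a+m-i)_i equals (-1)^i (1-a-m)_i. This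
    exhibits the Newton expansion with increment x = 1 - a - m from the base point n s + m, and
    their sum is 1 - c s.\<close>
  also have "\<dots> = (\<Sum>i\<le>m. pochhammer (1 - (a + of_nat m)) i / fact i
       * (fwd_diff ^^ i) (poly q) (of_nat (n s + m) - of_nat i)) / pochhammer a m"
    unfolding sum_divide_distrib
  proof (intro sum.cong refl)
    fix i assume "i \<in> {..m}"
    then have i: "i \<le> m" by simp
    have "pochhammer a m = pochhammer a (m - i) * pochhammer (a + of_nat (m - i)) i"
      using pochhammer_product[of "m - i" m a] i by simp
    moreover have "pochhammer (1 - (a + of_nat m)) i = (- 1) ^ i * pochhammer (a + of_nat (m - i)) i"
      using pochhammer_minus[of "a + of_nat m - 1" i] i by (simp add: of_nat_diff algebra_simps)
    moreover have "(- 1) ^ (m - i) * (- 1) ^ m = ((- 1) ^ i :: complex)"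
      using i by (auto simp: minus_one_power_iff)
    moreover have "of_nat (n s + m) - of_nat i = (of_nat (n s + (m - i)) :: complex)"
      using i by (simp add: of_nat_diff)
    ultimately show "w (m - i) * (- 1) ^ m = pochhammer (1 - (a + of_nat m)) i / fact i
       * (fwd_diff ^^ i) (poly q) (of_nat (n s + m) - of_nat i) / pochhammer a m"
      using a[of "m - i"] a[of m] i unfolding w_def by (simp add: field_simps)
  qed
  also have "\<dots> = poly q (1 - c s) / pochhammer a m"
    using q(2) by (subst backward_newton_poly) (auto simp: a_def)
  finally show "coeff (Q_poly p c n s) m
      = S_fun p c n s (1 - c s) / pochhammer (c s + of_nat (n s)) m"
    unfolding q(1) a_def .
qed

section \<open>Common expansion of \<open>K_fun\<close> and \<open>B_poly\<close>\<close>

text \<open>Both sides are (a)_(k+l) / ((a)_k (a)_l). This exchange turns the parameter quotient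
  (c+n)_k / (c)_k into P(k) / P(0).\<close>

lemma pochhammer_shift_quotient:
  fixes a :: complex
  assumes "a \<notin> \<int>\<^sub>\<le>\<^sub>0"
  shows "pochhammer (a + of_nat k) l / pochhammer a l = pochhammer (a + of_nat l) k / pochhammer a k"
proof -
  have "pochhammer a j \<noteq> 0" for j using assms by (auto simp: pochhammer_eq_0_iff)
  then show ?thesis
    using pochhammer_product'[of a k l] pochhammer_product'[of a l k]
    by (simp add: field_simps add.commute)
qed

lemma poch_list_map: "poch_list (map f [1..<Suc p]) k = (\<Prod>i=1..p. pochhammer (f i) k)"
  unfolding poch_list_def
  using prod.distinct_set_conv_list[of "[1..<Suc p]" "\<lambda>i. pochhammer (f i) k"]
  by (simp only: distinct_upt set_upt atLeastLessThanSuc_atLeastAtMost map_map comp_def simp_thms)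

lemma minus_of_nat_pochhammer:
  "d \<le> N \<Longrightarrow> pochhammer (- of_nat N) d = ((- 1) ^ d * fact N / fact (N - d) :: complex)"
  using gbinomial_pochhammer[of "of_nat N :: complex" d]
  by (simp add: binomial_fact minus_one_power_iff field_simps flip: binomial_gbinomial
      split: if_splits)

lemma K_fun_eq:
  assumes c: "\<forall>i\<in>{1..p}. c i \<notin> \<int>\<^sub>\<le>\<^sub>0" and N: "N = mi_size p n"
  shows "K_fun p c n z = fact N / P_fun p c n 0 *
    (\<Sum>d\<le>N. (- z) ^ d * (\<Sum>l\<le>N - d. (- 1) ^ (d + l) * P_fun p c n (of_nat (d + l))
                                    / (fact (N - d - l) * fact l)))"
proof -
  have quot: "(\<Prod>i=1..p. pochhammer (c i + of_nat (n i)) k) / (\<Prod>i=1..p. pochhammer (c i) k)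
      = P_fun p c n (of_nat k) / P_fun p c n 0" for k
    unfolding P_fun_def prod_dividef[symmetric]
    using c by (intro prod.cong) (auto simp: pochhammer_shift_quotient)
  define t where "t = (\<lambda>(u, l). pochhammer (- of_nat N) (u + l)
      * (P_fun p c n (of_nat (u + l)) / P_fun p c n 0) * ((- z) ^ u / fact l))"
  have "K_fun p c n z = (\<Sum>\<^sub>\<infinity>x\<in>UNIV. t x)"
    unfolding K_fun_def kampe_de_feriet_def N[symmetric] t_def
  proof (intro infsum_cong, clarify)
    fix u l
    show "poch_list (- of_nat N # map (\<lambda>i. c i + of_nat (n i)) [1..<Suc p]) (u + l) *
           poch_list [1] u * poch_list [] l /
           (poch_list (map c [1..<Suc p]) (u + l) * poch_list [] u * poch_list [] l) *
           ((- z) ^ u / fact u) * (1 ^ l / fact l)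
        = pochhammer (- of_nat N) (u + l)
      * (P_fun p c n (of_nat (u + l)) / P_fun p c n 0) * ((- z) ^ u / fact l)"
      unfolding quot[symmetric] poch_list_map[symmetric]
      \<comment> \<open>The parameter (1)_u is u! and cancels the factorial in the
        denominator.\<close>
      by (simp add: poch_list_def pochhammer_fact[symmetric] del: upt_Suc)
  qed
  \<comment> \<open>The factor (-N)_(u+l) vanishes for u + l > N, so the series lives on a finite
    triangle and raises no convergence question.\<close>
  also have "\<dots> = (\<Sum>\<^sub>\<infinity>x\<in>Sigma {..N} (\<lambda>u. {..N - u}). t x)"
    by (rule infsum_cong_neutral) (auto simp: t_def pochhammer_of_nat_eq_0_iff)
  also have "\<dots> = (\<Sum>d\<le>N. \<Sum>l\<le>N - d. t (d, l))"
    by (simp add: sum.Sigma)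
  also have "\<dots> = fact N / P_fun p c n 0 *
    (\<Sum>d\<le>N. (- z) ^ d * (\<Sum>l\<le>N - d. (- 1) ^ (d + l) * P_fun p c n (of_nat (d + l))
                                    / (fact (N - d - l) * fact l)))"
    unfolding sum_distrib_left
    by (intro sum.cong refl) (auto simp: t_def minus_of_nat_pochhammer field_simps)
  finally show ?thesis .
qed

text \<open>The power z^d collects the weights with K \<ge> d; put K = d + l. The K! in (-K)_d =
  (-1)^d K!/(K-d)! cancels the one in the weight and leaves the same inner sums as in
  \<open>K_fun_eq\<close>.\<close>

lemma poly_B_poly_eq:
  assumes N: "N = mi_size p n"
  shows "poly (B_poly p c n) z = 1 / P_fun p c n (of_nat N) *
    (\<Sum>d\<le>N. (- z) ^ d * (\<Sum>l\<le>N - d. (- 1) ^ (d + l) * P_fun p c n (of_nat (d + l))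
                                    / (fact (N - d - l) * fact l)))"
proof -
  have deg: "degree (B_poly p c n) \<le> N"
    by (rule degree_le) (auto simp: coeff_B_poly N)
  have inner: "(\<Sum>K=d..N. B_weight p c n K * pochhammer (- of_nat K) d)
     = - ((- 1) ^ d * (\<Sum>l\<le>N - d. (- 1) ^ (d + l) * P_fun p c n (of_nat (d + l))
                                    / (fact (N - d - l) * fact l)))" if "d \<le> N" for d
    unfolding sum.atLeastAtMost_shift_0[OF that] sum_distrib_left sum_negf[symmetric]
  proof (intro sum.cong)
    fix l assume "l \<in> {..N - d}"
    have "pochhammer (- of_nat (d + l)) d = ((- 1) ^ d * fact (d + l) / fact l :: complex)"
      using minus_of_nat_pochhammer[of d "d + l"] by simp
    then show "((\<lambda>K. B_weight p c n K * pochhammer (- of_nat K) d) \<circ> plus d) l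
       = - ((- 1) ^ d * ((- 1) ^ (d + l) * P_fun p c n (of_nat (d + l))
                                    / (fact (N - d - l) * fact l)))"
      by (simp add: B_weight_def N[symmetric] minus_one_power_iff del: of_nat_add)
  qed auto
  have "poly (B_poly p c n) z = (\<Sum>d\<le>N. coeff (B_poly p c n) d * z ^ d)"
    unfolding poly_altdef using deg
    by (intro sum.mono_neutral_left) (auto simp: coeff_eq_0)
  also have "\<dots> = (\<Sum>d\<le>N. 1 / P_fun p c n (of_nat N) * ((- z) ^ d * (\<Sum>l\<le>N - d.
      (- 1) ^ (d + l) * P_fun p c n (of_nat (d + l)) / (fact (N - d - l) * fact l))))"
    by (intro sum.cong refl)
       (simp add: coeff_B_poly N[symmetric] inner power_minus[of z])
  finally show ?thesis by (simp only: sum_distrib_left)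
qed

lemma alternating_sum_fwd_diff:
  assumes "d \<le> N"
  shows "(\<Sum>l\<le>N - d. (- 1) ^ (d + l) * F (of_nat (d + l)) / (fact (N - d - l) * fact l))
     = (- 1) ^ N / fact (N - d) * (fwd_diff ^^ (N - d)) F (of_nat d)"
  unfolding fwd_diff_funpow_explicit sum_distrib_left
proof (intro sum.cong refl)
  fix l assume "l \<in> {..N - d}"
  then have l: "l \<le> N - d" by simp
  then have N: "N = (N - d - l) + (d + l)" using assms by linarith
  have "(- 1) ^ N * (- 1) ^ (N - d - l) = ((- 1) ^ (d + l) :: complex)"
    by (subst N, unfold power_add[of _ "N - d - l"]) (simp add: minus_one_power_iff)
  then show "(- 1) ^ (d + l) * F (of_nat (d + l)) / (fact (N - d - l) * fact l)
     = (- 1) ^ N / fact (N - d) * (of_nat (N - d choose l) *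
         ((- 1) ^ (N - d - l) * F (of_nat d + of_nat l)))"
    using l by (simp add: binomial_fact field_simps)
qed

section \<open>The hypergeometric form and the zeros of \<open>Q_poly\<close>\<close>

text \<open>Shows that the series reading and the coefficientwise reading give the same finite sum,
  so that later arguments need no case distinction.\<close>

lemma hyp_xi_eq:
  assumes "0 \<notin> set xs"
  shows "hyp_xi N a xs z = (\<Sum>d\<le>N. pochhammer (- of_nat N) d * pochhammer a d
              * (\<Prod>x\<leftarrow>xs. (of_nat d - x) / (- x)) * z ^ d / fact d)"
proof (cases "set xs \<inter> of_nat ` {1..N} = {}")
  case True
  have fold: "foldl (\<lambda>r a. r * pochhammer a k) v as = v * poch_list as k" for v as and k :: nat
    by (induction as arbitrary: v) (simp_all add: poch_list_def mult.assoc)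
  define h where "h = fps_hypergeo ([- of_nat N, a] @ map (\<lambda>x. 1 - x) xs) (map uminus xs) 1"
  have h: "fps_nth h d = pochhammer (- of_nat N) d * pochhammer a d
      * (poch_list (map (\<lambda>x. 1 - x) xs) d / poch_list (map uminus xs) d) / fact d" for d
    unfolding h_def fps_hypergeo_nth fold by (simp add: poch_list_def)
  \<comment> \<open>The bound d \<le> N keeps (-x)_d nonzero. For d > N it may vanish, but such
    coefficients are zero anyway through (-N)_d.\<close>
  have quot: "poch_list (map (\<lambda>x. 1 - x) xs) d / poch_list (map uminus xs) d
      = (\<Prod>x\<leftarrow>xs. (of_nat d - x) / (- x))" if "d \<le> N" for d
    using assms True
  proof (induction xs)
    case (Cons x xs)
    have "pochhammer (- x) d \<noteq> 0"
    proof
      assume "pochhammer (- x) d = 0"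
      then obtain k where k: "k < d" "x = of_nat k" by (auto simp: pochhammer_eq_0_iff)
      then have "k \<in> {1..N}" using Cons.prems(1) that by (cases k) auto
      then show False using k(2) Cons.prems(2) by auto
    qed
    \<comment> \<open>Splits (-x)_(d+1) at its first and at its last factor; the quotient telescopes
      to (d-x)/(-x).\<close>
    moreover have "- x * pochhammer (1 - x) d = pochhammer (- x) d * (of_nat d - x)"
      using pochhammer_rec[of "- x" d] pochhammer_Suc[of "- x" d] by (simp add: algebra_simps)
    moreover have "x \<noteq> 0" using Cons.prems by auto
    ultimately have "pochhammer (1 - x) d / pochhammer (- x) d = (of_nat d - x) / (- x)"
      by (simp add: field_simps)
    moreover have "poch_list (map (\<lambda>x. 1 - x) xs) d / poch_list (map uminus xs) d
      = (\<Prod>x\<leftarrow>xs. (of_nat d - x) / (- x))"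
      using Cons.prems by (intro Cons.IH) auto
    moreover have "poch_list (map (\<lambda>x. 1 - x) (x # xs)) d / poch_list (map uminus (x # xs)) d
      = pochhammer (1 - x) d / pochhammer (- x) d
        * (poch_list (map (\<lambda>x. 1 - x) xs) d / poch_list (map uminus xs) d)"
      by (simp add: poch_list_def)
    ultimately show ?case by simp
  qed (simp add: poch_list_def)
  have "hyp_xi N a xs z = (\<Sum>d. fps_nth h d * z ^ d)"
    using True by (simp add: hyp_xi_def eval_fps_def h_def)
  also have "\<dots> = (\<Sum>d\<le>N. fps_nth h d * z ^ d)"
    by (rule suminf_finite) (auto simp: h pochhammer_of_nat_eq_0_iff)
  finally show ?thesis by (simp add: h quot)
next
  case False
  then show ?thesis by (simp add: hyp_xi_def atMost_atLeast0)
qed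

text \<open>Split \<open>q\<close> into linear factors over the complex numbers; the leading
  coefficient cancels in the quotient.\<close>

lemma poly_div_poly_0_eq_prod_roots:
  fixes q :: "complex poly"
  assumes "mset xs = proots q" and "poly q 0 \<noteq> 0"
  shows "poly q t / poly q 0 = (\<Prod>x\<leftarrow>xs. (t - x) / (- x))"
proof -
  have q: "q = smult (lead_coeff q) (\<Prod>x\<in>#proots q. [:- x, 1:])"
    by (rule complex_poly_decompose_multiset[symmetric])
  have eval: "poly q t = lead_coeff q * (\<Prod>x\<leftarrow>xs. t - x)" for t
  proof -
    have "poly q t = lead_coeff q * poly (\<Prod>x\<leftarrow>xs. [:- x, 1:]) t"
      by (subst q) (simp add: prod_mset_prod_list flip: assms(1) mset_map)
    also have "poly (\<Prod>x\<leftarrow>xs. [:- x, 1:]) t = (\<Prod>x\<leftarrow>xs. t - x)"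
      by (induction xs) (auto simp: algebra_simps)
    finally show ?thesis .
  qed
  have "lead_coeff q \<noteq> 0" using assms(2) by auto
  moreover have "(\<Prod>x\<leftarrow>xs. t - x) / (\<Prod>x\<leftarrow>xs. 0 - x) = (\<Prod>x\<leftarrow>xs. (t - x) / (- x))"
    by (induction xs) (auto simp: times_divide_times_eq[symmetric] simp del: times_divide_times_eq)
  ultimately show ?thesis by (simp add: eval)
qed

theorem corollary6p8:
  fixes p :: nat and b :: complex and \<kappa> c :: "nat \<Rightarrow> complex" and n :: "nat \<Rightarrow> nat"
    and N s m :: nat
  assumes "p \<ge> 1"
    and "\<forall>i\<in>{1..p}. \<forall>h\<in>{1..p}. i \<noteq> h \<longrightarrow> \<kappa> i - \<kappa> h \<notin> \<int>"
    and "c = (\<lambda>i. \<kappa> i + b + 1)"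
    and "\<forall>i\<in>{1..p}. c i \<notin> \<int>\<^sub>\<le>\<^sub>0"
    and "N = mi_size p n"
    and "s \<in> {1..p}"
    and "n s = Max (n ` {1..p})"
    and "m = N - n s"
  shows "(\<forall>z. poly (B_poly p c n) z
               = P_fun p c n 0 / (fact N * P_fun p c n (of_nat N)) * K_fun p c n z) \<and>
          poly (Q_poly p c n s) 0 = fact N / fact (n s) \<and>
          degree (Q_poly p c n s) = m \<and>
          coeff (Q_poly p c n s) m = S_fun p c n s (1 - c s) / pochhammer (c s + of_nat (n s)) m \<and>
          S_fun p c n s (1 - c s) / pochhammer (c s + of_nat (n s)) m
           = (\<Prod>i\<in>{1..p} - {s}. pochhammer (\<kappa> i - \<kappa> s + 1) (n i))
               / pochhammer (\<kappa> s + b + of_nat (n s) + 1) m \<and>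
          (\<forall>\<xi>. mset \<xi> = proots (Q_poly p c n s) \<longrightarrow>
           length \<xi> = m \<and> 0 \<notin> set \<xi> \<and>
           (\<forall>z. K_fun p c n z
                  = (- 1) ^ N * (fact N / P_fun p c n 0)
                      * hyp_xi N (c s + of_nat (n s)) \<xi> z) \<and>
           (\<forall>z. poly (B_poly p c n) z
                  = (- 1) ^ N / P_fun p c n (of_nat N)
                      * hyp_xi N (c s + of_nat (n s)) \<xi> z))"
proof -
  note kappa = assms(2) and c_def = assms(3) and c = assms(4) and N = assms(5) and s = assms(6)
    and m = assms(8)
  define Q where "Q = Q_poly p c n s"
  define a where "a = c s + of_nat (n s)"
  have P: "P_fun p c n (of_nat k) \<noteq> 0" for k by (rule P_fun_nonzero[OF c])
  have P0: "P_fun p c n 0 \<noteq> 0" using P[of 0] by simp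
  have a: "c s + of_nat (n s) \<notin> \<int>\<^sub>\<le>\<^sub>0"
  proof
    assume "c s + of_nat (n s) \<in> \<int>\<^sub>\<le>\<^sub>0"
    then have "c s + of_nat (n s) - of_nat (n s) \<in> \<int>\<^sub>\<le>\<^sub>0"
      by (rule nonpos_Ints_diff_Nats) simp
    then show False using c s by simp
  qed
  \<comment> \<open>Both expansions contain the same sum over d; only the prefactors N!/P(0) and
    1/P(N) differ.\<close>
  have BK: "poly (B_poly p c n) z
      = P_fun p c n 0 / (fact N * P_fun p c n (of_nat N)) * K_fun p c n z" for z
    unfolding K_fun_eq[OF c N] poly_B_poly_eq[OF N] using P0 by simp
  have Q0: "poly Q 0 = fact N / fact (n s)"
    unfolding Q_def N by (rule poly_Q_poly_0[OF s])
  have mN: "m = mi_size p n - n s" using m N by simp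
  have lc: "coeff Q m = S_fun p c n s (1 - c s) / pochhammer a m"
    unfolding Q_def a_def by (rule Q_poly_degree_coeff(2)[where c = c, OF s a mN])
  have S: "S_fun p c n s (1 - c s) = (\<Prod>i\<in>{1..p} - {s}. pochhammer (\<kappa> i - \<kappa> s + 1) (n i))"
    unfolding S_fun_def c_def by (intro prod.cong) (auto simp: algebra_simps)
  have a': "a = \<kappa> s + b + of_nat (n s) + 1" by (simp add: a_def c_def)
  \<comment> \<open>A zero factor would make \<kappa> i - \<kappa> s a negative integer. Hence the
    coefficient of x^m in \<open>Q\<close> is nonzero and its degree is exactly m.\<close>
  have "pochhammer (\<kappa> i - \<kappa> s + 1) (n i) \<noteq> 0" if "i \<in> {1..p} - {s}" for i
  proof
    assume "pochhammer (\<kappa> i - \<kappa> s + 1) (n i) = 0"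
    then obtain k where "\<kappa> i - \<kappa> s + 1 = - of_nat k" by (auto simp: pochhammer_eq_0_iff)
    then have "\<kappa> i - \<kappa> s = of_int (- int k - 1)" by (simp add: algebra_simps)
    then have "\<kappa> i - \<kappa> s \<in> \<int>" by (metis Ints_of_int)
    then show False using kappa s that by auto
  qed
  moreover have "pochhammer a m \<noteq> 0" using a unfolding a_def pochhammer_eq_0_iff by auto
  ultimately have "coeff Q m \<noteq> 0" unfolding lc S by simp
  then have deg: "degree Q = m"
    using Q_poly_degree_coeff(1)[where c = c, OF s a mN] le_degree[of Q m] by (simp add: Q_def)
  have roots: "length \<xi> = m \<and> 0 \<notin> set \<xi> \<and>
      (\<forall>z. K_fun p c n z = (- 1) ^ N * (fact N / P_fun p c n 0) * hyp_xi N a \<xi> z) \<and>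
      (\<forall>z. poly (B_poly p c n) z = (- 1) ^ N / P_fun p c n (of_nat N) * hyp_xi N a \<xi> z)"
    if xi: "mset \<xi> = proots Q" for \<xi>
  proof -
    have Q0': "poly Q 0 \<noteq> 0" using Q0 by simp
    have len: "length \<xi> = m" using size_proots_complex[of Q] deg by (simp flip: xi)
    have "Q \<noteq> 0" using Q0' by auto
    then have "set \<xi> = {x. poly Q x = 0}" using xi by (metis set_mset_mset set_count_proots)
    then have 0: "0 \<notin> set \<xi>" using Q0' by auto
    have B: "poly (B_poly p c n) z = (- 1) ^ N / P_fun p c n (of_nat N) * hyp_xi N a \<xi> z" for z
    proof -
      \<comment> \<open>Comparison of the coefficients of z^d. Here Q(d) is Q(0) times the product
        over the zeros; the factorial of \<open>n s\<close> from the difference formula cancels the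
        one in Q(0), and the N! left over belongs to (-N)_d.\<close>
      have "(- z) ^ d * (\<Sum>l\<le>N - d. (- 1) ^ (d + l) * P_fun p c n (of_nat (d + l))
                                    / (fact (N - d - l) * fact l))
         = (- 1) ^ N * (pochhammer (- of_nat N) d * pochhammer a d
              * (\<Prod>x\<leftarrow>\<xi>. (of_nat d - x) / (- x)) * z ^ d / fact d)" if "d \<le> N" for d
        unfolding alternating_sum_fwd_diff[OF that] fwd_diff_P_fun[where c = c, OF s a N that]
          poly_div_poly_0_eq_prod_roots[OF xi Q0', symmetric] Q0 Q_def[symmetric] a_def[symmetric]
          minus_of_nat_pochhammer[OF that] power_minus[of z]
        by simp
      then have "(\<Sum>d\<le>N. (- z) ^ d * (\<Sum>l\<le>N - d. (- 1) ^ (d + l) * P_fun p c n (of_nat (d + l))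
                                    / (fact (N - d - l) * fact l)))
         = (\<Sum>d\<le>N. (- 1) ^ N * (pochhammer (- of_nat N) d * pochhammer a d
              * (\<Prod>x\<leftarrow>\<xi>. (of_nat d - x) / (- x)) * z ^ d / fact d))"
        by (intro sum.cong refl) (simp only: atMost_iff)
      then show ?thesis
        unfolding poly_B_poly_eq[OF N] hyp_xi_eq[OF 0] sum_distrib_left[symmetric] by simp
    qed
    \<comment> \<open>Solves \<open>BK\<close> for \<open>K_fun\<close>, which is possible as P(0)
      and P(N) are nonzero.\<close>
    have K: "K_fun p c n z = (- 1) ^ N * (fact N / P_fun p c n 0) * hyp_xi N a \<xi> z" for z
      using BK[of z] B[of z] P0 P[of N] by (simp add: field_simps)
    show ?thesis using len 0 B K by simp
  qed
  show ?thesis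
    unfolding Q_def[symmetric] a_def[symmetric] a'[symmetric]
    using BK Q0 deg lc S roots by (simp only: simp_thms) blast
qed

end
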